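(* The inverse monoid $\mathrm{PT}$ is $F$-inverse.
   Context: A tree is a nonempty prefix-closed finitely branching set $A\subseteq(\mathbb N^+)^*$ with $wj\in A$, $i<j$ implying $wi\in A$. A permutation tree is a map $t:A\to\mathrm{Sym}(\mathbb N^+)$ (possibly infinite) such that a node with exactly $n$ children has label in $S_n$ (permutations of $\mathbb N^+$ fixing all $i>n$). Write $t=\langle\pi;t_1,..,t_n\rangle$; $\bar\epsilon$ is the one-node tree. $\mathrm{PT}$ is the set of permutation trees. Product (coinductive): $t\bar\epsilon=t=\bar\epsilon t$; for $t=\langle\pi;t_1..t_n\rangle$, $u=\langle\rho;u_1..u_m\rangle$: if $n\ge m$, $tu=\langle\pi\circ\rho;u_1t_{\rho1},..,u_mt_{\rho m},t_{m+1},..,t_n\rangle$; if $m\ge n$, $tu=\langle\pi\circ\rho;u_1t_{\rho1},..,u_mt_{\rho m}\rangle$ with $t_j:=\bar\epsilon$ for $j>n$. $\bar\epsilon^*=\bar\epsilon$, $t^*=\langle\pi^{-1};(t_{\pi^{-1}1})^*,..,(t_{\pi^{-1}n})^*\rangle$; this makes $\mathrm{PT}$ an inverse monoid. Natural order $u\le v$ iff $uu^*v=u$; $t\,\sigma\,u$ iff some $w$ has $w\le t$, $w\le u$; an inverse monoid is $F$-inverse if every $\sigma$-class has a unique maximal element. *)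

theory Defs
  imports "HOL-Algebra.Group" "HOL-Combinatorics.Permutations"
begin

text \<open>Positive integers are represented by nonzero elements of \<^typ>\<open>nat\<close>; a permutation
  of the positive integers fixing all \<open>i > n\<close> is thus a function that \<open>permutes {1..n}\<close>.\<close>

definition tree :: "nat list set \<Rightarrow> bool" where
  "tree A \<longleftrightarrow> A \<noteq> {}
     \<and> (\<forall>w\<in>A. set w \<subseteq> {1..})
     \<and> (\<forall>v w. v @ w \<in> A \<longrightarrow> v \<in> A)
     \<and> (\<forall>w\<in>A. finite {j. w @ [j] \<in> A})
     \<and> (\<forall>w i j. w @ [j] \<in> A \<longrightarrow> 1 \<le> i \<longrightarrow> i < j \<longrightarrow> w @ [i] \<in> A)"

type_synonym labelled_tree = "nat list \<Rightarrow> (nat \<Rightarrow> nat) option"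

definition perm_tree :: "labelled_tree \<Rightarrow> bool" where
  "perm_tree t \<longleftrightarrow> tree (dom t)
     \<and> (\<forall>w \<pi>. t w = Some \<pi> \<longrightarrow> \<pi> permutes {1..card {j. w @ [j] \<in> dom t}})"

definition pt_one :: labelled_tree where
  "pt_one = [[] \<mapsto> id]"

definition root_label :: "labelled_tree \<Rightarrow> nat \<Rightarrow> nat" where
  "root_label t = the (t [])"

definition arity :: "labelled_tree \<Rightarrow> nat" where
  "arity t = card {j. [j] \<in> dom t}"

text \<open>The subtree \<open>t\<^sub>j\<close>, with the convention that it is the one-node tree if
  \<open>j\<close> is not the index of a child of the root.\<close>

definition branch :: "labelled_tree \<Rightarrow> nat \<Rightarrow> labelled_tree" where
  "branch t j = (if j \<in> {1..arity t} then (\<lambda>w. t (j # w)) else pt_one)"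

text \<open>\<open>node \<pi> n f\<close> is the tree \<open>\<langle>\<pi>; f 1, \<dots>, f n\<rangle>\<close>.\<close>

definition node :: "(nat \<Rightarrow> nat) \<Rightarrow> nat \<Rightarrow> (nat \<Rightarrow> labelled_tree) \<Rightarrow> labelled_tree" where
  "node \<pi> n f w = (case w of [] \<Rightarrow> Some \<pi> | j # v \<Rightarrow> if j \<in> {1..n} then f j v else None)"

text \<open>The corecursive equations for product and involution determine the value at a node by
  recursion on the word of that node; the equations themselves are the lemmas
  \<open>pt_mult_ge\<close>, \<open>pt_mult_le\<close> and \<open>pt_star_node\<close> below.\<close>

fun pt_mult :: "labelled_tree \<Rightarrow> labelled_tree \<Rightarrow> nat list \<Rightarrow> (nat \<Rightarrow> nat) option" where
  "pt_mult t u [] = Some (root_label t \<circ> root_label u)"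
| "pt_mult t u (j # w) =
     (if j \<in> {1..arity u} then pt_mult (branch u j) (branch t (root_label u j)) w
      else if j \<in> {arity u<..arity t} then branch t j w
      else None)"

text \<open>The notation \<open>inv\<close> for inverse functions is shadowed by the one for groups.\<close>

fun pt_star :: "labelled_tree \<Rightarrow> nat list \<Rightarrow> (nat \<Rightarrow> nat) option" where
  "pt_star t [] = Some (inv_into UNIV (root_label t))"
| "pt_star t (j # w) =
     (if j \<in> {1..arity t} then pt_star (branch t (inv_into UNIV (root_label t) j)) w else None)"

lemma pt_mult_ge:
  assumes "arity t \<ge> arity u"
  shows "pt_mult t u = node (root_label t \<circ> root_label u) (arity t)
    (\<lambda>j. if j \<le> arity u then pt_mult (branch u j) (branch t (root_label u j)) else branch t j)"
proof
  fix w show "pt_mult t u w = node (root_label t \<circ> root_label u) (arity t)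
    (\<lambda>j. if j \<le> arity u then pt_mult (branch u j) (branch t (root_label u j)) else branch t j) w"
    using assms by (cases w) (auto simp: node_def)
qed

lemma pt_mult_le:
  assumes "arity u \<ge> arity t"
  shows "pt_mult t u = node (root_label t \<circ> root_label u) (arity u)
    (\<lambda>j. pt_mult (branch u j) (branch t (root_label u j)))"
proof
  fix w show "pt_mult t u w = node (root_label t \<circ> root_label u) (arity u)
    (\<lambda>j. pt_mult (branch u j) (branch t (root_label u j))) w"
    using assms by (cases w) (auto simp: node_def)
qed

lemma pt_star_node:
  "pt_star t = node (inv_into UNIV (root_label t)) (arity t)
    (\<lambda>j. pt_star (branch t (inv_into UNIV (root_label t) j)))"
proof
  fix w show "pt_star t w = node (inv_into UNIV (root_label t)) (arity t)
    (\<lambda>j. pt_star (branch t (inv_into UNIV (root_label t) j))) w"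
    by (cases w) (auto simp: node_def)
qed

lemma one_simps [simp]:
  "root_label pt_one = id" "arity pt_one = 0" "branch pt_one j = pt_one"
  by (auto simp: root_label_def arity_def branch_def pt_one_def)

lemma pt_star_one: "pt_star pt_one = pt_one"
proof
  fix w show "pt_star pt_one w = pt_one w"
    by (cases w) (simp_all, simp_all add: pt_one_def)
qed

lemma tree_children:
  assumes "tree A" "w \<in> A"
  shows "{j. w @ [j] \<in> A} = {1..card {j. w @ [j] \<in> A}}"
proof -
  let ?C = "{j. w @ [j] \<in> A}"
  have fin: "finite ?C" using assms unfolding tree_def by blast
  have pos: "1 \<le> j" if "j \<in> ?C" for j
  proof -
    from that have "w @ [j] \<in> A" by simp
    then have "set (w @ [j]) \<subseteq> {1..}" using assms(1) unfolding tree_def by blast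
    then show ?thesis by simp
  qed
  have down: "i \<in> ?C" if "j \<in> ?C" "1 \<le> i" "i < j" for i j
    using that assms(1) unfolding tree_def by blast
  show ?thesis
  proof (cases "?C = {}")
    case False
    have M: "Max ?C \<in> ?C" using fin False by (rule Max_in)
    have eq: "?C = {1..Max ?C}"
    proof (rule subset_antisym; rule subsetI)
      fix i assume "i \<in> ?C"
      then show "i \<in> {1..Max ?C}" using pos[of i] Max_ge[OF fin, of i] by simp
    next
      fix i assume "i \<in> {1..Max ?C}"
      then show "i \<in> ?C" using down[OF M, of i] M by (cases "i = Max ?C") auto
    qed
    have "card ?C = Max ?C" using arg_cong[OF eq, of card]
      unfolding card_atLeastAtMost diff_Suc_1 .
    then show ?thesis by (rule ssubst) (rule eq)
  qed simp
qed

lemma tree_prefix: "tree A \<Longrightarrow> v @ w \<in> A \<Longrightarrow> v \<in> A"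
  unfolding tree_def by blast

lemma perm_tree_root:
  assumes "perm_tree t"
  shows "t [] = Some (root_label t)" "{j. [j] \<in> dom t} = {1..arity t}"
    "root_label t permutes {1..arity t}"
proof -
  have T: "tree (dom t)" using assms by (simp add: perm_tree_def)
  then have "dom t \<noteq> {}" unfolding tree_def by (rule conjunct1)
  then obtain w where "w \<in> dom t" by (meson ex_in_conv)
  then have N: "[] \<in> dom t" using tree_prefix[OF T, of "[]" w] by simp
  then show R: "t [] = Some (root_label t)" by (auto simp: root_label_def)
  show "{j. [j] \<in> dom t} = {1..arity t}"
    using tree_children[OF T N] by (simp add: arity_def)
  have "root_label t permutes {1..card {j. [] @ [j] \<in> dom t}}"
    using assms R unfolding perm_tree_def by blast
  then show "root_label t permutes {1..arity t}" by (simp add: arity_def)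
qed

lemma perm_tree_outside:
  assumes "perm_tree t" "j \<notin> {1..arity t}"
  shows "t (j # w) = None"
proof (rule ccontr)
  assume "t (j # w) \<noteq> None"
  then have "[j] @ w \<in> dom t" by auto
  moreover have "tree (dom t)" using assms(1) by (simp add: perm_tree_def)
  ultimately have "[j] \<in> dom t" by (rule tree_prefix[rotated])
  then show False using perm_tree_root(2)[OF assms(1)] assms(2) by blast
qed

lemma perm_tree_node:
  assumes "perm_tree t"
  shows "t = node (root_label t) (arity t) (branch t)"
  using perm_tree_root(1)[OF assms] perm_tree_outside[OF assms]
  by (auto simp: node_def branch_def fun_eq_iff split: list.split)

lemma perm_tree_one: "perm_tree pt_one"
  by (auto simp: perm_tree_def tree_def pt_one_def)

lemma perm_tree_branch:
  assumes "perm_tree t"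
  shows "perm_tree (branch t j)"
proof (cases "j \<in> {1..arity t}")
  case False then show ?thesis by (auto simp: branch_def perm_tree_one)
next
  case True
  have dom: "w \<in> dom (branch t j) \<longleftrightarrow> j # w \<in> dom t" for w
    using True by (simp add: branch_def domIff)
  have T: "tree (dom t)"
    and P: "\<And>w \<pi>. t w = Some \<pi> \<Longrightarrow> \<pi> permutes {1..card {j. w @ [j] \<in> dom t}}"
    using assms by (auto simp: perm_tree_def)
  have "[j] \<in> dom t" using perm_tree_root(2)[OF assms] True by blast
  then have "[] \<in> dom (branch t j)" by (simp add: dom)
  moreover have "set w \<subseteq> {1..}" if "w \<in> dom (branch t j)" for w
  proof -
    have "set (j # w) \<subseteq> {1..}" using that T unfolding dom tree_def by blast
    then show ?thesis by simp
  qed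
  moreover have "v \<in> dom (branch t j)" if "v @ w \<in> dom (branch t j)" for v w
    using that tree_prefix[OF T, of "j # v" w] by (simp add: dom)
  moreover have "finite {i. w @ [i] \<in> dom (branch t j)}" if "w \<in> dom (branch t j)" for w
  proof -
    have "finite {i. (j # w) @ [i] \<in> dom t}" using that T unfolding dom tree_def by blast
    then show ?thesis by (simp add: dom)
  qed
  moreover have "w @ [i] \<in> dom (branch t j)"
    if "w @ [k] \<in> dom (branch t j)" "1 \<le> i" "i < k" for w i k
  proof -
    have "(j # w) @ [k] \<in> dom t" using that(1) by (simp add: dom)
    then have "(j # w) @ [i] \<in> dom t" using that(2,3) T unfolding tree_def by blast
    then show ?thesis by (simp add: dom)
  qed
  ultimately have "tree (dom (branch t j))"
    unfolding tree_def by (intro conjI ballI allI impI) (blast | assumption)+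
  moreover have "\<pi> permutes {1..card {i. w @ [i] \<in> dom (branch t j)}}"
    if "branch t j w = Some \<pi>" for w \<pi>
  proof -
    have "t (j # w) = Some \<pi>" using that True by (simp add: branch_def)
    from P[OF this] show ?thesis by (simp add: dom)
  qed
  ultimately show ?thesis by (simp add: perm_tree_def)
qed

lemma pt_mult_one_right:
  assumes "perm_tree t"
  shows "pt_mult t pt_one = t"
proof
  fix w show "pt_mult t pt_one w = t w"
    using perm_tree_root(1)[OF assms] perm_tree_outside[OF assms]
    by (cases w) (auto simp: branch_def)
qed

lemma pt_mult_one_left:
  assumes "perm_tree t"
  shows "pt_mult pt_one t = t"
proof
  fix w from assms show "pt_mult pt_one t w = t w"
  proof (induction w arbitrary: t)
    case Nil then show ?case by (simp add: perm_tree_root(1))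
  next
    case (Cons j w)
    then show ?case using perm_tree_branch[OF Cons.prems, of j]
      perm_tree_outside[OF Cons.prems, of j w]
      pt_mult_one_right[of "branch t j"] by (auto simp: branch_def)
  qed
qed

record 'a star_monoid = "'a monoid" +
  star :: "'a \<Rightarrow> 'a" (\<open>(_\<^sup>\<star>\<index>)\<close> [1000] 999)

locale inverse_monoid = monoid M for M (structure) +
  assumes star_closed: "x \<in> carrier M \<Longrightarrow> x\<^sup>\<star> \<in> carrier M"
    and mult_star_mult: "x \<in> carrier M \<Longrightarrow> x \<otimes> x\<^sup>\<star> \<otimes> x = x"
    and star_mult_star: "x \<in> carrier M \<Longrightarrow> x\<^sup>\<star> \<otimes> x \<otimes> x\<^sup>\<star> = x\<^sup>\<star>"
    and star_unique: "\<lbrakk>x \<in> carrier M; y \<in> carrier M; x \<otimes> y \<otimes> x = x; y \<otimes> x \<otimes> y = y\<rbrakk>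
      \<Longrightarrow> y = x\<^sup>\<star>"

definition natural_le :: "('a, 'b) star_monoid_scheme \<Rightarrow> 'a \<Rightarrow> 'a \<Rightarrow> bool"
    (\<open>(_/ \<preceq>\<index> _)\<close> [51, 51] 50) where
  "u \<preceq>\<^bsub>M\<^esub> v \<longleftrightarrow> u \<otimes>\<^bsub>M\<^esub> u\<^sup>\<star>\<^bsub>M\<^esub> \<otimes>\<^bsub>M\<^esub> v = u"

definition sigma :: "('a, 'b) star_monoid_scheme \<Rightarrow> 'a rel" where
  "sigma M = {(t, u). t \<in> carrier M \<and> u \<in> carrier M
     \<and> (\<exists>w \<in> carrier M. w \<preceq>\<^bsub>M\<^esub> t \<and> w \<preceq>\<^bsub>M\<^esub> u)}"

locale F_inverse_monoid = inverse_monoid +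
  assumes unique_maximal:
    "C \<in> carrier M // sigma M \<Longrightarrow> \<exists>!m. m \<in> C \<and> (\<forall>x\<in>C. m \<preceq> x \<longrightarrow> x = m)"

definition PT :: "labelled_tree star_monoid" where
  "PT = \<lparr>carrier = {t. perm_tree t}, monoid.mult = pt_mult, one = pt_one, star = pt_star\<rparr>"

end

theory Submission
  imports Defs
begin

text \<open>Extending a permutation tree by identity labels to all words turns it into a total
  labelling \<open>ext t\<close>. The natural order compares two trees with the same extension by reverse
  inclusion of their domains, and two trees are \<open>\<sigma>\<close>-related iff their extensions agree, the
  union of the domains giving a common lower bound. Hence a \<open>\<sigma>\<close>-class has a greatest element:
  the common extension, restricted to the intersection of all domains occurring in the class.
  At a node of the intersection the number of children is the least one occurring, so it is
  attained by some member of the class and the label is admissible.\<close>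

section \<open>Coinduction for permutation trees\<close>

text \<open>A word is read letter by letter: each letter passes to a child that satisfies
  \<open>X\<close> again. So the subtree at any node of \<open>t\<close> satisfies \<open>X\<close>,
  and every condition on a permutation tree reduces to the one-step decomposition given by
  \<open>step\<close>.\<close>

lemma perm_tree_coinduct:
  assumes "X t"
    and step: "\<And>t. X t \<Longrightarrow> \<exists>\<pi> n f. t = node \<pi> n f \<and> \<pi> permutes {1..n} \<and> (\<forall>j\<in>{1..n}. X (f j))"
  shows "perm_tree t"
proof -
  have nil: "t [] \<noteq> None" if "X t" for t
    using step[OF that] by (auto simp: node_def)
  have cons: "j \<ge> 1 \<and> X (\<lambda>w. t (j # w))" if X: "X t" "t (j # v) \<noteq> None" for t j v
  proof -
    obtain \<pi> n f where t: "t = node \<pi> n f" "\<forall>j\<in>{1..n}. X (f j)"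
      using step[OF X(1)] by blast
    then have "j \<in> {1..n}" using X(2) by (auto simp: node_def split: if_splits)
    then show ?thesis using t by (simp add: node_def eta_contract_eq)
  qed
  have sub: "X (\<lambda>w. t (v @ w))" if "X t" "t v \<noteq> None" for t v
    using that
  proof (induction v arbitrary: t)
    case (Cons j v)
    show ?case using Cons.IH[of "\<lambda>w. t (j # w)"] cons[OF Cons.prems] Cons.prems by simp
  qed simp
  have pos: "set v \<subseteq> {1..}" if "X t" "t v \<noteq> None" for t v
    using that
  proof (induction v arbitrary: t)
    case (Cons j v)
    show ?case using Cons.IH[of "\<lambda>w. t (j # w)"] cons[OF Cons.prems] Cons.prems by simp
  qed simp
  have prefix: "t v \<noteq> None" if "X t" "t (v @ w) \<noteq> None" for t v w
    using that
  proof (induction v arbitrary: t)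
    case Nil then show ?case by (simp add: nil)
  next
    case (Cons j v)
    show ?case
      using Cons.IH[of "\<lambda>w. t (j # w)"] cons[OF Cons.prems(1), of j "v @ w"] Cons.prems by simp
  qed
  \<comment> \<open>Decomposing the subtree at \<open>v\<close> yields its children and its label
    together. The root of each \<open>f j\<close> is defined because \<open>X (f j)\<close> holds,
    so no index in \<open>{1..n}\<close> is missing.\<close>
  have children: "\<exists>n. {j. v @ [j] \<in> dom t} = {1..n} \<and> the (t v) permutes {1..n}"
    if v: "t v \<noteq> None" for v
  proof -
    obtain \<pi> n f where f: "(\<lambda>w. t (v @ w)) = node \<pi> n f" "\<pi> permutes {1..n}"
        "\<forall>j\<in>{1..n}. X (f j)"
      using step[OF sub[OF \<open>X t\<close> v]] by blast
    have "t (v @ [j]) \<noteq> None \<longleftrightarrow> j \<in> {1..n}" for j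
      using fun_cong[OF f(1), of "[j]"] f(3) nil[of "f j"] by (auto simp: node_def)
    then have "{j. v @ [j] \<in> dom t} = {1..n}" by blast
    moreover have "t v = Some \<pi>" using fun_cong[OF f(1), of "[]"] by (simp add: node_def)
    ultimately show ?thesis using f(2) by auto
  qed
  have "tree (dom t)"
    unfolding tree_def
  proof (intro conjI ballI allI impI)
    show "dom t \<noteq> {}" using nil[OF \<open>X t\<close>] by auto
    show "set w \<subseteq> {1..}" if "w \<in> dom t" for w using pos[OF \<open>X t\<close>] that by blast
    show "v \<in> dom t" if "v @ w \<in> dom t" for v w using prefix[OF \<open>X t\<close>] that by blast
    show "finite {j. w @ [j] \<in> dom t}" if w: "w \<in> dom t" for w
    proof -
      obtain n where "{j. w @ [j] \<in> dom t} = {1..n}" using children w by blast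
      then show ?thesis by (rule ssubst) simp
    qed
    show "w @ [i] \<in> dom t" if w: "w @ [j] \<in> dom t" "1 \<le> i" "i < j" for w i j
    proof -
      obtain n where n: "{j. w @ [j] \<in> dom t} = {1..n}"
        using children prefix[OF \<open>X t\<close>, of w "[j]"] w(1) by blast
      have "j \<in> {1..n}" using w(1) n by blast
      then have "i \<in> {1..n}" using w by simp
      then show ?thesis using n by blast
    qed
  qed
  moreover have "\<pi> permutes {1..card {j. w @ [j] \<in> dom t}}" if w: "t w = Some \<pi>" for w \<pi>
  proof -
    obtain n where n: "{j. w @ [j] \<in> dom t} = {1..n}" "the (t w) permutes {1..n}"
      using children w by blast
    show ?thesis unfolding n(1) using n(2) w by simp
  qed
  ultimately show ?thesis by (simp add: perm_tree_def)
qed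

text \<open>The symmetric disjunct accommodates the order reversal in the branches of a product.\<close>

lemma perm_tree_eq_coinduct:
  assumes "R t u"
    and step: "\<And>t u. R t u \<Longrightarrow> perm_tree t \<and> perm_tree u \<and> root_label t = root_label u
      \<and> arity t = arity u
      \<and> (\<forall>j. R (branch t j) (branch u j) \<or> R (branch u j) (branch t j))"
  shows "t = u"
proof
  fix w
  show "t w = u w"
    using assms(1)
  proof (induction w arbitrary: t u)
    case Nil
    then show ?case using step[OF Nil] by (simp add: perm_tree_root(1))
  next
    case (Cons j w)
    note s = step[OF Cons.prems]
    \<comment> \<open>The induction hypothesis is general in both trees, so it also applies to the
      swapped pair; the resulting equation is symmetric.\<close>
    have "branch t j w = branch u j w" using s Cons.IH by metis
    then show ?case using s perm_tree_outside[of t j w] perm_tree_outside[of u j w]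
      by (cases "j \<in> {1..arity t}") (simp_all add: branch_def)
  qed
qed

section \<open>Root label, arity and branches of a node\<close>

lemma arity_node:
  assumes "\<And>j. j \<in> {1..n} \<Longrightarrow> perm_tree (f j)"
  shows "arity (node \<pi> n f) = n"
proof -
  have "f j [] \<noteq> None" if "j \<in> {1..n}" for j
    using perm_tree_root(1)[OF assms[OF that]] by simp
  then have "{j. [j] \<in> dom (node \<pi> n f)} = {1..n}"
    by (auto simp: node_def domIff split: if_splits)
  then show ?thesis unfolding arity_def by (rule ssubst) simp
qed

lemma root_label_node: "root_label (node \<pi> n f) = \<pi>"
  by (simp add: root_label_def node_def)

lemma branch_node:
  assumes "\<And>j. j \<in> {1..n} \<Longrightarrow> perm_tree (f j)"
  shows "branch (node \<pi> n f) j = (if j \<in> {1..n} then f j else pt_one)"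
  using arity_node[OF assms] by (simp add: branch_def node_def fun_eq_iff)

lemma branch_outside: "j \<notin> {1..arity t} \<Longrightarrow> branch t j = pt_one"
  by (auto simp: branch_def)

lemma root_label_outside: "perm_tree t \<Longrightarrow> j \<notin> {1..arity t} \<Longrightarrow> root_label t j = j"
  using perm_tree_root(3) permutes_not_in by metis

lemma root_label_bij: "perm_tree t \<Longrightarrow> bij (root_label t)"
  using perm_tree_root(3) permutes_bij by blast

lemma root_label_inverse [simp]:
  assumes "perm_tree t"
  shows "inv_into UNIV (root_label t) (root_label t j) = j"
    "root_label t (inv_into UNIV (root_label t) j) = j"
    "inv_into UNIV (root_label t) \<circ> root_label t = id"
    "root_label t \<circ> inv_into UNIV (root_label t) = id"
  using root_label_bij[OF assms]
  by (simp_all add: bij_is_inj bij_is_surj surj_f_inv_f fun_eq_iff)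

section \<open>The inverse monoid of permutation trees\<close>

text \<open>Both cases of the product merge into one formula. For \<open>j\<close> beyond the arity
  of \<open>u\<close>, the label of \<open>u\<close> fixes \<open>j\<close> and
  \<open>branch u j\<close> is the unit, so the general branch is just
  \<open>branch t j\<close>.\<close>

lemma pt_mult_node:
  assumes t: "perm_tree t" and u: "perm_tree u"
  shows "pt_mult t u = node (root_label t \<circ> root_label u) (max (arity t) (arity u))
    (\<lambda>j. pt_mult (branch u j) (branch t (root_label u j)))"
proof
  fix w
  show "pt_mult t u w = node (root_label t \<circ> root_label u) (max (arity t) (arity u))
    (\<lambda>j. pt_mult (branch u j) (branch t (root_label u j))) w"
  proof (cases w)
    case (Cons j v)
    show ?thesis
    proof (cases "j \<in> {arity u<..arity t}")
      case True
      then show ?thesis using Cons root_label_outside[OF u, of j] branch_outside[of j u]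
        by (simp add: node_def pt_mult_one_left perm_tree_branch t)
    qed (use Cons in \<open>auto simp: node_def\<close>)
  qed (simp add: node_def)
qed

lemma perm_tree_mult [simp]:
  assumes "perm_tree t" "perm_tree u"
  shows "perm_tree (pt_mult t u)"
\<comment> \<open>The branches of a product are again products of permutation trees, with the
  factors in reverse order, so the set of all products is closed under taking branches.\<close>
proof (rule perm_tree_coinduct[where X = "\<lambda>x. \<exists>t u. perm_tree t \<and> perm_tree u \<and> x = pt_mult t u"])
  fix x assume "\<exists>t u. perm_tree t \<and> perm_tree u \<and> x = pt_mult t u"
  then obtain t u where x: "perm_tree t" "perm_tree u" "x = pt_mult t u" by blast
  have "root_label t permutes {1..max (arity t) (arity u)}"
    "root_label u permutes {1..max (arity t) (arity u)}"
    using permutes_subset[OF perm_tree_root(3)[OF x(1)]]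
      permutes_subset[OF perm_tree_root(3)[OF x(2)]] by simp_all
  then have "root_label t \<circ> root_label u permutes {1..max (arity t) (arity u)}"
    by (rule permutes_compose[rotated])
  then show "\<exists>\<pi> n f. x = node \<pi> n f \<and> \<pi> permutes {1..n} \<and>
      (\<forall>j\<in>{1..n}. \<exists>t u. perm_tree t \<and> perm_tree u \<and> f j = pt_mult t u)"
    using pt_mult_node[OF x(1,2)] x perm_tree_branch by blast
qed (use assms in blast)

text \<open>The branch equation holds for every \<open>j\<close>: beyond both arities each side is
  the unit. Coinductive arguments can therefore ignore the range of \<open>j\<close>.\<close>

lemma pt_mult_simps [simp]:
  assumes "perm_tree t" "perm_tree u"
  shows "root_label (pt_mult t u) = root_label t \<circ> root_label u"
    "arity (pt_mult t u) = max (arity t) (arity u)"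
    "branch (pt_mult t u) j = pt_mult (branch u j) (branch t (root_label u j))"
proof -
  note p = perm_tree_mult[OF perm_tree_branch[OF assms(2)] perm_tree_branch[OF assms(1)]]
  show "root_label (pt_mult t u) = root_label t \<circ> root_label u"
    by (subst pt_mult_node[OF assms]) (rule root_label_node)
  show "arity (pt_mult t u) = max (arity t) (arity u)"
    by (subst pt_mult_node[OF assms]) (rule arity_node[OF p])
  show "branch (pt_mult t u) j = pt_mult (branch u j) (branch t (root_label u j))"
  proof (cases "j \<in> {1..max (arity t) (arity u)}")
    case True
    then show ?thesis by (subst pt_mult_node[OF assms]) (simp add: branch_node p)
  next
    case False
    then have "j \<notin> {1..arity t}" "j \<notin> {1..arity u}" by auto
    then have "pt_mult (branch u j) (branch t (root_label u j)) = pt_one"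
      using root_label_outside[OF assms(2)]
      by (simp add: branch_outside pt_mult_one_right perm_tree_one)
    with False show ?thesis
      by (subst pt_mult_node[OF assms]) (simp add: branch_node p)
  qed
qed

lemma perm_tree_star [simp]:
  assumes "perm_tree t"
  shows "perm_tree (pt_star t)"
proof (rule perm_tree_coinduct[where X = "\<lambda>x. \<exists>t. perm_tree t \<and> x = pt_star t"])
  fix x assume "\<exists>t. perm_tree t \<and> x = pt_star t"
  then obtain t where x: "perm_tree t" "x = pt_star t" by blast
  show "\<exists>\<pi> n f. x = node \<pi> n f \<and> \<pi> permutes {1..n} \<and>
      (\<forall>j\<in>{1..n}. \<exists>t. perm_tree t \<and> f j = pt_star t)"
    using pt_star_node[of t] x perm_tree_branch permutes_inv[OF perm_tree_root(3)[OF x(1)]]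
    by blast
qed (use assms in blast)

lemma pt_star_simps [simp]:
  assumes "perm_tree t"
  shows "root_label (pt_star t) = inv_into UNIV (root_label t)"
    "arity (pt_star t) = arity t"
    "branch (pt_star t) j = pt_star (branch t (inv_into UNIV (root_label t) j))"
proof -
  note p = perm_tree_star[OF perm_tree_branch[OF assms]]
  show "root_label (pt_star t) = inv_into UNIV (root_label t)"
    by (subst pt_star_node) (rule root_label_node)
  show "arity (pt_star t) = arity t"
    by (subst pt_star_node) (rule arity_node[OF p])
  show "branch (pt_star t) j = pt_star (branch t (inv_into UNIV (root_label t) j))"
  proof (cases "j \<in> {1..arity t}")
    case True
    then show ?thesis by (subst pt_star_node) (simp add: branch_node p)
  next
    case False
    then have "inv_into UNIV (root_label t) j = j"
      using root_label_outside[OF assms False] root_label_inverse(1)[OF assms, of j] by simp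
    with False have "pt_star (branch t (inv_into UNIV (root_label t) j)) = pt_one"
      by (simp add: branch_outside pt_star_one)
    with False show ?thesis
      by (subst pt_star_node) (simp add: branch_node p)
  qed
qed

lemma pt_mult_assoc:
  assumes "perm_tree t" "perm_tree u" "perm_tree v"
  shows "pt_mult (pt_mult t u) v = pt_mult t (pt_mult u v)"
proof -
  define R where "R x y \<longleftrightarrow> (\<exists>t u v. perm_tree t \<and> perm_tree u \<and> perm_tree v
    \<and> x = pt_mult (pt_mult t u) v \<and> y = pt_mult t (pt_mult u v))" for x y
  have R: "R (pt_mult (pt_mult t u) v) (pt_mult t (pt_mult u v))"
    if "perm_tree t" "perm_tree u" "perm_tree v" for t u v
    unfolding R_def using that by blast
  have step: "perm_tree x \<and> perm_tree y \<and> root_label x = root_label y \<and> arity x = arity y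
      \<and> (\<forall>j. R (branch x j) (branch y j) \<or> R (branch y j) (branch x j))" if xy: "R x y" for x y
  proof -
    obtain t u v where t: "perm_tree t" and u: "perm_tree u" and v: "perm_tree v"
      and x: "x = pt_mult (pt_mult t u) v" and y: "y = pt_mult t (pt_mult u v)"
      using xy by (auto simp: R_def)
    \<comment> \<open>Both branches multiply the same three trees in reverse order. The reversal
      also exchanges the two bracketings, which is why \<open>x\<close> and \<open>y\<close> change
      places here.\<close>
    have "R (branch y j) (branch x j)" for j
      using R[of "branch v j" "branch u (root_label v j)" "branch t (root_label u (root_label v j))"]
      by (simp add: x y t u v perm_tree_branch)
    then show ?thesis by (simp add: x y t u v comp_assoc max.assoc)
  qed
  from R[OF assms] show ?thesis by (rule perm_tree_eq_coinduct) (rule step)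
qed

text \<open>The labels cancel along \<open>j\<close>, so the branch at \<open>j\<close> is the same
  triple product formed from \<open>branch t j\<close>, after reassociation.\<close>

lemma pt_mult_star_mult:
  assumes "perm_tree t"
  shows "pt_mult (pt_mult t (pt_star t)) t = t"
  by (rule perm_tree_eq_coinduct[where R = "\<lambda>x t. perm_tree t
      \<and> x = pt_mult (pt_mult t (pt_star t)) t"])
    (use assms in \<open>auto simp: comp_assoc perm_tree_branch pt_mult_assoc\<close>)

lemma pt_star_mult_star:
  assumes "perm_tree t"
  shows "pt_mult (pt_mult (pt_star t) t) (pt_star t) = pt_star t"
proof -
  define R where "R x y \<longleftrightarrow> (\<exists>t. perm_tree t
    \<and> x = pt_mult (pt_mult (pt_star t) t) (pt_star t) \<and> y = pt_star t)" for x y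
  have step: "perm_tree x \<and> perm_tree y \<and> root_label x = root_label y \<and> arity x = arity y
      \<and> (\<forall>j. R (branch x j) (branch y j) \<or> R (branch y j) (branch x j))" if xy: "R x y" for x y
  proof -
    obtain t where t: "perm_tree t" "x = pt_mult (pt_mult (pt_star t) t) (pt_star t)"
      "y = pt_star t" using xy by (auto simp: R_def)
    have "R (branch x j) (branch y j)" for j
      unfolding R_def using t
      \<comment> \<open>The star moves the branches, so position \<open>j\<close> carries the star
        of the branch of \<open>t\<close> at the preimage of \<open>j\<close>.\<close>
      by (intro exI[of _ "branch t (inv_into UNIV (root_label t) j)"])
        (simp add: perm_tree_branch pt_mult_assoc)
    then show ?thesis using t by (simp add: comp_assoc)
  qed
  have "R (pt_mult (pt_mult (pt_star t) t) (pt_star t)) (pt_star t)"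
    unfolding R_def using assms by blast
  then show ?thesis by (rule perm_tree_eq_coinduct) (rule step)
qed

text \<open>The relation pairs each inverse of a tree with the star of that tree. At the root,
  permutations cancel and the two equations bound each arity by the other. Below it,
  \<open>branch u j\<close> and \<open>branch t (root_label u j)\<close> are again mutually
  inverse.\<close>

lemma pt_star_unique:
  assumes "perm_tree t" "perm_tree u"
    and "pt_mult (pt_mult t u) t = t" "pt_mult (pt_mult u t) u = u"
  shows "u = pt_star t"
proof -
  define R where "R u s \<longleftrightarrow> (\<exists>t. perm_tree t \<and> perm_tree u
    \<and> pt_mult (pt_mult t u) t = t \<and> pt_mult (pt_mult u t) u = u \<and> s = pt_star t)" for u s
  have step: "perm_tree u \<and> perm_tree s \<and> root_label u = root_label s \<and> arity u = arity s
      \<and> (\<forall>j. R (branch u j) (branch s j) \<or> R (branch s j) (branch u j))" if us: "R u s" for u s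
  proof -
    obtain t where t: "perm_tree t" and u: "perm_tree u" and s: "s = pt_star t"
      and tut: "pt_mult (pt_mult t u) t = t" and utu: "pt_mult (pt_mult u t) u = u"
      using us by (auto simp: R_def)
    have "root_label t \<circ> root_label u \<circ> root_label t = root_label t"
      using arg_cong[OF tut, of root_label] t u by simp
    then have "root_label t (root_label u (root_label t j)) = root_label t j" for j
      by (simp add: fun_eq_iff)
    then have ut: "root_label u (root_label t j) = j" for j
      using root_label_bij[OF t] by (simp add: bij_is_inj inj_eq)
    have "root_label u j = inv_into UNIV (root_label t) j" for j
      using ut[of "inv_into UNIV (root_label t) j"] t by simp
    then have label: "root_label u = inv_into UNIV (root_label t)" ..
    have tb: "pt_mult (pt_mult (branch t j) (branch u (root_label t j))) (branch t j) = branch t j"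
      for j using arg_cong[OF tut, of "\<lambda>x. branch x j"] t u ut[of j]
      by (simp add: perm_tree_branch pt_mult_assoc)
    have ub: "pt_mult (pt_mult (branch u j) (branch t (root_label u j))) (branch u j) = branch u j"
      for j using arg_cong[OF utu, of "\<lambda>x. branch x j"] t u label
      by (simp add: perm_tree_branch pt_mult_assoc)
    have ar: "arity u = arity t"
      using arg_cong[OF tut, of arity] arg_cong[OF utu, of arity] t u by simp
    have "R (branch u j) (branch s j)" for j
      unfolding R_def using tb[of "root_label u j"] ub[of j] t u s label
      by (intro exI[of _ "branch t (root_label u j)"]) (simp add: perm_tree_branch)
    then show ?thesis using t u s label ar by simp
  qed
  have "R u (pt_star t)" unfolding R_def using assms by blast
  then show ?thesis by (rule perm_tree_eq_coinduct) (rule step)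
qed

lemma PT_simps [simp]:
  "carrier PT = {t. perm_tree t}" "t \<otimes>\<^bsub>PT\<^esub> u = pt_mult t u" "\<one>\<^bsub>PT\<^esub> = pt_one"
  "t\<^sup>\<star>\<^bsub>PT\<^esub> = pt_star t"
  by (simp_all add: PT_def)

lemma inverse_monoid_PT: "inverse_monoid PT"
  by unfold_locales
    (simp_all add: perm_tree_one pt_mult_one_left pt_mult_one_right pt_mult_star_mult
      pt_star_mult_star pt_star_unique, simp add: pt_mult_assoc)

section \<open>The natural order and the least group congruence\<close>

definition ext :: "labelled_tree \<Rightarrow> nat list \<Rightarrow> nat \<Rightarrow> nat" where
  "ext t w = (case t w of None \<Rightarrow> id | Some \<pi> \<Rightarrow> \<pi>)"

text \<open>If \<open>j\<close> is not a child of the root, both sides are the identity, since the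
  default branch carries only identity labels.\<close>

lemma ext_branch:
  assumes "perm_tree t"
  shows "ext (branch t j) w = ext t (j # w)"
proof (cases "j \<in> {1..arity t}")
  case False
  then show ?thesis using perm_tree_outside[OF assms False, of w]
    by (auto simp: ext_def branch_def pt_one_def)
qed (simp add: ext_def branch_def)

lemma ext_Nil: "perm_tree t \<Longrightarrow> ext t [] = root_label t"
  by (simp add: ext_def perm_tree_root(1))

lemma Cons_in_dom_iff:
  assumes "perm_tree t"
  shows "j # w \<in> dom t \<longleftrightarrow> j \<in> {1..arity t} \<and> w \<in> dom (branch t j)"
  using perm_tree_outside[OF assms, of j w] by (auto simp: branch_def domIff)

text \<open>This will be the natural order with \<open>u\<close> below \<open>t\<close>: the smaller
  element has the larger domain.\<close>

definition extends :: "labelled_tree \<Rightarrow> labelled_tree \<Rightarrow> bool" where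
  "extends u t \<longleftrightarrow> perm_tree u \<and> perm_tree t \<and> dom t \<subseteq> dom u \<and> ext u = ext t"

lemma extends_branch:
  assumes "extends u t"
  shows "extends (branch u j) (branch t j)"
proof -
  have u: "perm_tree u" and t: "perm_tree t" and d: "dom t \<subseteq> dom u" and e: "ext u = ext t"
    using assms by (auto simp: extends_def)
  have "w \<in> dom (branch u j)" if "w \<in> dom (branch t j)" for w
  proof (cases "j \<in> {1..arity t}")
    case True
    then show ?thesis using that d Cons_in_dom_iff[OF t, of j w] Cons_in_dom_iff[OF u, of j w] by blast
  next
    case False
    \<comment> \<open>A missing child of \<open>t\<close> is replaced by the one-node tree, whose
      only node is the root, and the root lies in every tree.\<close>
    then have "w = []" using that by (auto simp: branch_def pt_one_def split: if_splits)
    then show ?thesis using perm_tree_root(1)[OF perm_tree_branch[OF u]] by blast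
  qed
  then show ?thesis using u t e ext_branch[OF u, of j] ext_branch[OF t, of j]
    by (auto simp: extends_def perm_tree_branch fun_eq_iff)
qed

lemma extends_root_label: "extends u t \<Longrightarrow> root_label u = root_label t"
  by (metis extends_def ext_Nil)

lemma extends_arity:
  assumes "extends u t"
  shows "arity t \<le> arity u"
proof -
  have "{j. [j] \<in> dom t} \<subseteq> {j. [j] \<in> dom u}" using assms by (auto simp: extends_def)
  then have "{1..arity t} \<subseteq> {1..arity u}"
    using assms perm_tree_root(2) unfolding extends_def by metis
  then show ?thesis by (cases "arity t = 0") auto
qed

text \<open>The order reversal in the branches of a product exchanges the two equations, so neither
  can be proved without the other.\<close>

lemma extends_imp_absorb:
  assumes "extends u t"
  shows "pt_mult (pt_mult u (pt_star u)) t = u" "pt_mult (pt_mult t (pt_star u)) u = u"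
proof -
  define R where "R x u \<longleftrightarrow> (\<exists>t. extends u t \<and>
    (x = pt_mult (pt_mult u (pt_star u)) t \<or> x = pt_mult (pt_mult t (pt_star u)) u))" for x u
  have step: "perm_tree x \<and> perm_tree u \<and> root_label x = root_label u \<and> arity x = arity u
      \<and> (\<forall>j. R (branch x j) (branch u j) \<or> R (branch u j) (branch x j))" if xu: "R x u" for x u
  proof -
    obtain t where ut: "extends u t" and
      x: "x = pt_mult (pt_mult u (pt_star u)) t \<or> x = pt_mult (pt_mult t (pt_star u)) u"
      using xu by (auto simp: R_def)
    have u: "perm_tree u" and t: "perm_tree t" using ut by (auto simp: extends_def)
    have r: "root_label t = root_label u" using extends_root_label[OF ut] by simp
    \<comment> \<open>The labels of \<open>t\<close> and \<open>u\<close> agree, so the inverse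
      label cancels either one and all three factors are taken at the same index
      \<open>j\<close>.\<close>
    have "branch x j = pt_mult (pt_mult (branch t j) (pt_star (branch u j))) (branch u j) \<or>
      branch x j = pt_mult (pt_mult (branch u j) (pt_star (branch u j))) (branch t j)" for j
      using x u t root_label_inverse[OF u] r by (auto simp: perm_tree_branch pt_mult_assoc)
    then have "R (branch x j) (branch u j)" for j
      unfolding R_def using extends_branch[OF ut, of j] by blast
    then show ?thesis
      using x u t root_label_inverse[OF u] r extends_arity[OF ut] by (auto simp: comp_assoc)
  qed
  have "R (pt_mult (pt_mult u (pt_star u)) t) u" unfolding R_def using assms by blast
  then show "pt_mult (pt_mult u (pt_star u)) t = u"
    by (rule perm_tree_eq_coinduct) (rule step)
  have "R (pt_mult (pt_mult t (pt_star u)) u) u" unfolding R_def using assms by blast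
  then show "pt_mult (pt_mult t (pt_star u)) u = u"
    by (rule perm_tree_eq_coinduct) (rule step)
qed

text \<open>Induction on the word: comparing roots gives equal labels and
  \<open>arity t \<le> arity u\<close>. Passing to a branch turns one absorption equation into the
  other, so the hypothesis has to be their disjunction.\<close>

lemma absorb_imp_extends:
  assumes "perm_tree u" "perm_tree t"
    and "pt_mult (pt_mult u (pt_star u)) t = u \<or> pt_mult (pt_mult t (pt_star u)) u = u"
  shows "extends u t"
proof -
  have "(w \<in> dom t \<longrightarrow> w \<in> dom u) \<and> ext u w = ext t w" for w
    using assms
  proof (induction w arbitrary: u t)
    case (Nil u t)
    note u = Nil.prems(1) and t = Nil.prems(2)
    have "root_label t = root_label u"
      using Nil.prems(3)
    proof
      assume "pt_mult (pt_mult u (pt_star u)) t = u"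
      from arg_cong[OF this, of root_label] show ?thesis using u t by simp
    next
      assume "pt_mult (pt_mult t (pt_star u)) u = u"
      from arg_cong[OF this, of root_label] show ?thesis using u t by (simp add: comp_assoc)
    qed
    then show ?case using u t by (auto simp: ext_Nil perm_tree_root(1))
  next
    case (Cons j w u t)
    note u = Cons.prems(1) and t = Cons.prems(2)
    have r: "root_label t = root_label u" "arity t \<le> arity u"
      using Cons.prems(3)
    proof (atomize (full), elim disjE)
      assume *: "pt_mult (pt_mult u (pt_star u)) t = u"
      show "root_label t = root_label u \<and> arity t \<le> arity u"
        using arg_cong[OF *, of root_label] arg_cong[OF *, of arity] u t by simp
    next
      assume *: "pt_mult (pt_mult t (pt_star u)) u = u"
      show "root_label t = root_label u \<and> arity t \<le> arity u"
        using arg_cong[OF *, of root_label] arg_cong[OF *, of arity] u t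
        by (simp add: comp_assoc)
    qed
    have "pt_mult (pt_mult (branch u j) (pt_star (branch u j))) (branch t j) = branch u j \<or>
      pt_mult (pt_mult (branch t j) (pt_star (branch u j))) (branch u j) = branch u j"
      using Cons.prems(3)
    proof
      assume "pt_mult (pt_mult u (pt_star u)) t = u"
      from arg_cong[OF this, of "\<lambda>x. branch x j"] show ?thesis
        using u t r(1) by (simp add: perm_tree_branch pt_mult_assoc)
    next
      assume "pt_mult (pt_mult t (pt_star u)) u = u"
      from arg_cong[OF this, of "\<lambda>x. branch x j"] show ?thesis
        using u t r(1) by (simp add: perm_tree_branch pt_mult_assoc)
    qed
    from Cons.IH[OF perm_tree_branch[OF u] perm_tree_branch[OF t] this]
    show ?case using r(2) u t by (auto simp: ext_branch Cons_in_dom_iff simp del: domIff)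
  qed
  then show ?thesis using assms by (auto simp: extends_def)
qed

lemma natural_le_PT_iff:
  assumes "perm_tree u" "perm_tree t"
  shows "u \<preceq>\<^bsub>PT\<^esub> t \<longleftrightarrow> dom t \<subseteq> dom u \<and> ext u = ext t"
proof -
  have "u \<preceq>\<^bsub>PT\<^esub> t \<longleftrightarrow> extends u t"
    unfolding natural_le_def PT_simps using extends_imp_absorb(1) absorb_imp_extends assms by blast
  then show ?thesis using assms unfolding extends_def by blast
qed

section \<open>Restricting a total labelling to a tree\<close>

text \<open>Naming the set of children instead of its cardinality makes the bound monotone in the
  domain, so that \<open>permutes_subset\<close> applies when the domain is enlarged.\<close>

lemma ext_permutes:
  assumes "perm_tree t" "w \<in> dom t"
  shows "ext t w permutes {j. w @ [j] \<in> dom t}"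
proof -
  obtain \<pi> where "t w = Some \<pi>" using assms(2) by blast
  then have "ext t w permutes {1..card {j. w @ [j] \<in> dom t}}"
    using assms(1) by (simp add: perm_tree_def ext_def)
  moreover have "tree (dom t)" using assms(1) by (simp add: perm_tree_def)
  ultimately show ?thesis using tree_children[OF _ assms(2)] by metis
qed

lemma ext_outside: "w \<notin> dom t \<Longrightarrow> ext t w = id"
  by (auto simp: ext_def domIff)

definition restrict_labels :: "(nat list \<Rightarrow> nat \<Rightarrow> nat) \<Rightarrow> nat list set \<Rightarrow> labelled_tree" where
  "restrict_labels f D w = (if w \<in> D then Some (f w) else None)"

lemma dom_restrict_labels [simp]: "dom (restrict_labels f D) = D"
  by (auto simp: restrict_labels_def dom_def)

lemma ext_restrict_labels:
  assumes "\<And>w. w \<notin> D \<Longrightarrow> f w = id"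
  shows "ext (restrict_labels f D) = f"
  using assms by (auto simp: ext_def restrict_labels_def)

text \<open>A tree is thus determined by its extension and its domain; antisymmetry of the natural
  order rests on this.\<close>

lemma restrict_labels_ext: "restrict_labels (ext t) (dom t) = t"
  by (auto simp: restrict_labels_def ext_def domIff fun_eq_iff)

lemma perm_tree_restrict_labels:
  assumes "tree D" "\<And>w. w \<in> D \<Longrightarrow> f w permutes {j. w @ [j] \<in> D}"
  shows "perm_tree (restrict_labels f D)"
  unfolding perm_tree_def dom_restrict_labels
proof (intro conjI allI impI)
  fix w \<pi> assume "restrict_labels f D w = Some \<pi>"
  then have w: "w \<in> D" "\<pi> = f w" by (auto simp: restrict_labels_def split: if_splits)
  then show "\<pi> permutes {1..card {j. w @ [j] \<in> D}}"
    using assms(2) tree_children[OF assms(1)] by metis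
qed (rule assms(1))

lemma tree_Un:
  assumes "tree A" "tree B"
  shows "tree (A \<union> B)"
proof -
  \<comment> \<open>A node of the union may lie in only one of the trees, so finiteness is extended
    to words outside the tree, which have no children by prefix closure.\<close>
  have fin: "finite {j. w @ [j] \<in> A}" if "tree A" for w :: "nat list" and A
  proof (cases "w \<in> A")
    case False
    then have "{j. w @ [j] \<in> A} = {}" using tree_prefix[OF that] by blast
    then show ?thesis by (rule ssubst) simp
  qed (use that in \<open>auto simp: tree_def\<close>)
  have "finite {j. w @ [j] \<in> A \<union> B}" for w :: "nat list"
    using fin[OF assms(1), of w] fin[OF assms(2), of w] by (simp add: Collect_disj_eq)
  then show ?thesis
    unfolding tree_def
  proof (intro conjI ballI allI impI, goal_cases)
    case 1 then show ?case using assms unfolding tree_def by blast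
  next
    case 2 then show ?case using assms unfolding tree_def by blast
  next
    case 3 then show ?case using assms tree_prefix by blast
  next
    case 4 then show ?case by blast
  next
    case 5 then show ?case using assms unfolding tree_def by blast
  qed
qed

lemma tree_Nil: "tree A \<Longrightarrow> [] \<in> A"
  using tree_prefix[of A "[]"] unfolding tree_def by (metis append_Nil ex_in_conv)

text \<open>The root lies in every tree, so the intersection is nonempty; any single member bounds
  the branching.\<close>

lemma tree_Inter:
  assumes "\<A> \<noteq> {}" "\<And>A. A \<in> \<A> \<Longrightarrow> tree A"
  shows "tree (\<Inter>\<A>)"
proof -
  obtain A where A: "A \<in> \<A>" using assms(1) by blast
  show ?thesis
    unfolding tree_def
  proof (intro conjI ballI allI impI)
    show "\<Inter>\<A> \<noteq> {}" using tree_Nil assms(2) by blast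
    show "set w \<subseteq> {1..}" if "w \<in> \<Inter>\<A>" for w
      using assms(2)[OF A] that A unfolding tree_def by blast
    show "v \<in> \<Inter>\<A>" if "v @ w \<in> \<Inter>\<A>" for v w
      using assms(2) tree_prefix that by blast
    show "finite {j. w @ [j] \<in> \<Inter>\<A>}" if "w \<in> \<Inter>\<A>" for w
    proof (rule finite_subset)
      show "{j. w @ [j] \<in> \<Inter>\<A>} \<subseteq> {j. w @ [j] \<in> A}" using A by blast
      show "finite {j. w @ [j] \<in> A}"
        using assms(2)[OF A] that A unfolding tree_def by blast
    qed
    show "w @ [i] \<in> \<Inter>\<A>" if "w @ [j] \<in> \<Inter>\<A>" "1 \<le> i" "i < j" for w i j
      using that assms(2) unfolding tree_def by blast
  qed
qed

section \<open>The classes of sigma and their greatest elements\<close>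

lemma sigma_PT_iff:
  "(t, u) \<in> sigma PT \<longleftrightarrow> perm_tree t \<and> perm_tree u \<and> ext t = ext u"
proof
  assume "(t, u) \<in> sigma PT"
  then obtain w where "perm_tree t" "perm_tree u" "perm_tree w" "w \<preceq>\<^bsub>PT\<^esub> t" "w \<preceq>\<^bsub>PT\<^esub> u"
    unfolding sigma_def by auto
  then show "perm_tree t \<and> perm_tree u \<and> ext t = ext u"
    by (metis natural_le_PT_iff)
next
  assume *: "perm_tree t \<and> perm_tree u \<and> ext t = ext u"
  define D where "D = dom t \<union> dom u"
  define w where "w = restrict_labels (ext t) D"
  \<comment> \<open>At a node belonging to \<open>u\<close> alone, the common label is read off from
    \<open>u\<close> instead.\<close>
  have "ext t v permutes {j. v @ [j] \<in> D}" if v: "v \<in> D" for v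
  proof (cases "v \<in> dom t")
    case True
    show ?thesis by (rule permutes_subset[OF ext_permutes[OF _ True]]) (use * in \<open>auto simp: D_def\<close>)
  next
    case False
    then have "v \<in> dom u" using v D_def by blast
    then have "ext u v permutes {j. v @ [j] \<in> D}"
      by (rule permutes_subset[OF ext_permutes[rotated]]) (use * in \<open>auto simp: D_def\<close>)
    then show ?thesis using * by simp
  qed
  moreover have "tree D" using * tree_Un unfolding D_def perm_tree_def by blast
  ultimately have w: "perm_tree w" unfolding w_def by (rule perm_tree_restrict_labels[rotated])
  have "ext w = ext t"
    unfolding w_def by (rule ext_restrict_labels) (simp add: D_def ext_outside)
  moreover have "dom w = D" unfolding w_def by simp
  ultimately have "w \<preceq>\<^bsub>PT\<^esub> t" "w \<preceq>\<^bsub>PT\<^esub> u"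
    using * w by (simp_all add: natural_le_PT_iff D_def)
  then have "\<exists>w \<in> carrier PT. w \<preceq>\<^bsub>PT\<^esub> t \<and> w \<preceq>\<^bsub>PT\<^esub> u"
    using w by (intro bexI[of _ w]) simp_all
  then show "(t, u) \<in> sigma PT" unfolding sigma_def using * by simp
qed

lemma sigma_class_PT:
  assumes "C \<in> carrier PT // sigma PT"
  obtains t where "perm_tree t" "C = {x. perm_tree x \<and> ext x = ext t}"
proof -
  obtain t where t: "t \<in> carrier PT" and C: "C = sigma PT `` {t}"
    using assms unfolding quotient_def by blast
  show thesis
  proof (rule that)
    show "perm_tree t" using t by simp
    then show "C = {x. perm_tree x \<and> ext x = ext t}"
      unfolding C Image_singleton sigma_PT_iff by auto
  qed
qed

lemma sigma_class_greatest:
  assumes "C \<in> carrier PT // sigma PT"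
  obtains m where "m \<in> C" "\<And>x. x \<in> C \<Longrightarrow> x \<preceq>\<^bsub>PT\<^esub> m"
proof -
  obtain t where t: "perm_tree t" and "C = {x. perm_tree x \<and> ext x = ext t}"
    using sigma_class_PT[OF assms] .
  then have C: "x \<in> C \<longleftrightarrow> perm_tree x \<and> ext x = ext t" for x
    by simp
  define D where "D = \<Inter>(dom ` C)"
  define m where "m = restrict_labels (ext t) D"
  have D: "tree D"
    unfolding D_def
  proof (rule tree_Inter)
    show "dom ` C \<noteq> {}" using C t by blast
    show "tree A" if "A \<in> dom ` C" for A using C that unfolding perm_tree_def by blast
  qed
  have "ext t w permutes {j. w @ [j] \<in> D}" if w: "w \<in> D" for w
  proof -
    define c where "c = card {j. w @ [j] \<in> D}"
    have c: "{j. w @ [j] \<in> D} = {1..c}" unfolding c_def by (rule tree_children[OF D w])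
    have "Suc c \<notin> {j. w @ [j] \<in> D}" unfolding c by simp
    \<comment> \<open>Some member of the class omits the first index that is not a child in
      \<open>D\<close>. Its children at \<open>w\<close> are then exactly those in \<open>D\<close>,
      so its label at \<open>w\<close> is admissible there.\<close>
    then obtain x where x: "x \<in> C" "w @ [Suc c] \<notin> dom x" unfolding D_def by blast
    have wx: "w \<in> dom x" using w x(1) unfolding D_def by blast
    define n where "n = card {j. w @ [j] \<in> dom x}"
    have n: "{j. w @ [j] \<in> dom x} = {1..n}" unfolding n_def
      by (rule tree_children[OF _ wx]) (use x(1) C in \<open>unfold perm_tree_def, blast\<close>)
    have "{1..c} \<subseteq> {1..n}" unfolding c[symmetric] n[symmetric] using x(1) D_def by blast
    moreover have "Suc c \<notin> {1..n}" unfolding n[symmetric] using x(2) by blast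
    \<comment> \<open>For \<open>c = 0\<close> the inclusion says nothing, and \<open>n = 0\<close>
      follows from the omitted index alone.\<close>
    ultimately have "c = n" by (cases "c = 0") auto
    moreover have "perm_tree x" "ext x = ext t" using x(1) C by blast+
    ultimately show ?thesis using ext_permutes[OF _ wx] n c by metis
  qed
  with D have m: "perm_tree m" unfolding m_def by (rule perm_tree_restrict_labels)
  have "ext t w = id" if w: "w \<notin> D" for w
  proof -
    obtain x where x: "x \<in> C" "w \<notin> dom x" using w unfolding D_def by blast
    then have "ext x = ext t" using C by blast
    then show ?thesis using ext_outside[OF x(2)] by simp
  qed
  then have e: "ext m = ext t" unfolding m_def by (rule ext_restrict_labels)
  show thesis
  proof (rule that)
    show "m \<in> C" using C m e by blast
    show "x \<preceq>\<^bsub>PT\<^esub> m" if "x \<in> C" for x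
    proof -
      have "perm_tree x" "ext x = ext t" using that C by blast+
      moreover have "dom m \<subseteq> dom x" using that unfolding m_def D_def by auto
      ultimately show ?thesis using m e by (simp add: natural_le_PT_iff)
    qed
  qed
qed

lemma natural_le_PT_antisym:
  assumes "perm_tree t" "perm_tree u" "t \<preceq>\<^bsub>PT\<^esub> u" "u \<preceq>\<^bsub>PT\<^esub> t"
  shows "t = u"
proof -
  have "dom t = dom u" "ext t = ext u"
    using assms by (simp_all add: natural_le_PT_iff subset_antisym)
  then show ?thesis by (metis restrict_labels_ext)
qed

theorem theorem3p11: "F_inverse_monoid PT"
proof (rule F_inverse_monoid.intro[OF inverse_monoid_PT], unfold_locales)
  fix C assume C: "C \<in> carrier PT // sigma PT"
  have perm: "perm_tree x" if "x \<in> C" for x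
    using sigma_class_PT[OF C] that by blast
  obtain m where m: "m \<in> C" and greatest: "\<And>x. x \<in> C \<Longrightarrow> x \<preceq>\<^bsub>PT\<^esub> m"
    using sigma_class_greatest[OF C] by blast
  show "\<exists>!m. m \<in> C \<and> (\<forall>x\<in>C. m \<preceq>\<^bsub>PT\<^esub> x \<longrightarrow> x = m)"
  proof (rule ex1I[of _ m])
    \<comment> \<open>An element of the class above \<open>m\<close> is also below it, hence equal
      to it by antisymmetry.\<close>
    show "m \<in> C \<and> (\<forall>x\<in>C. m \<preceq>\<^bsub>PT\<^esub> x \<longrightarrow> x = m)"
      using m natural_le_PT_antisym[OF perm perm _ greatest] by metis
    \<comment> \<open>A maximal \<open>x\<close> lies below the greatest element \<open>m\<close> of
      its class, so its maximality can be applied to \<open>m\<close>.\<close>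
    show "x = m" if "x \<in> C \<and> (\<forall>y\<in>C. x \<preceq>\<^bsub>PT\<^esub> y \<longrightarrow> y = x)" for x
      using that m greatest by metis
  qed
qed

end
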